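(* Consider a $K$-armed bandit with standard Gaussian noise. Let $n\ge2$ be an integer, let $\pi$ be any strategy, and let $\mu\in[0,1]^K$ be such that $\frac{n\Delta_i^2}{k_{i,1/2}\log(n)}\ge1$ for all $i$ with $\Delta_i>0$. Then at least one of the following holds: 1. $\displaystyle R^\pi_\mu(n)\ge\frac14\sum_{i:\Delta_i>0}\frac1{\Delta_i}\log\left(\frac{n\Delta_i^2}{k_{i,1/2}\log(n)}\right)$. 2. There exists an $i$ with $\Delta_i>0$ such that $$R^\pi_{\mu'}(n)\ge\frac12\sum_{j:\Delta'_j>0}\frac1{\Delta'_j}\log\left(\frac{n(\Delta'_j)^2}{k'_{j,1/2}\log(n)}\right),$$ where $\mu'_i=\mu_i+2\Delta_i$ and $\mu'_j=\mu_j$ for $j\ne i$, and $\Delta'_j$ and $k'_{j,1/2}$ are defined as $\Delta_j$ and $k_{j,1/2}$ but using $\mu'$ in place of $\mu$.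
   Context: In each round $t=1,\dots,n$ a strategy $\pi$ chooses an arm $I_t\in\{1,\dots,K\}$ based on past observations and receives $X_t=\mu_{I_t}+\eta_t$, where the noise terms $\eta_t$ are independent standard Gaussians. The pseudo-regret is $R^\pi_\mu(n)=n\max_j\mu_j-\mathbb{E}\sum_{t=1}^n\mu_{I_t}$. The gaps are $\Delta_i=\max_j\mu_j-\mu_i$, and for $\Delta_i>0$, $k_{i,1/2}=\sum_{j=1}^K\min\{1,\Delta_i/\Delta_j\}$, where a term with $\Delta_j=0$ equals $1$. *)

theory Defs
  imports "HOL-Probability.Probability"
begin

text \<open>
  The arms are the elements of a finite type \<open>'a\<close>, so \<open>K = CARD('a)\<close>. Rounds are numbered
  \<open>0, \<dots>, n - 1\<close>. The history before round \<open>t\<close> is an element of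
  \<open>\<Pi>\<^sub>M s\<in>{..<t}. count_space UNIV \<Otimes>\<^sub>M borel\<close>, recording (arm, reward) for every earlier round.
\<close>

type_synonym 'a history = "nat \<Rightarrow> 'a \<times> real"

abbreviation history_space :: "nat \<Rightarrow> 'a history measure" where
  "history_space t \<equiv> \<Pi>\<^sub>M s\<in>{..<t}. (count_space UNIV \<Otimes>\<^sub>M borel)"

text \<open>
  Strategies may randomise: \<open>R\<close> is the probability space of a private seed, drawn once and
  independently of the noise. A deterministic strategy is the case of a one-point \<open>R\<close>.
\<close>

definition strategy :: "'r measure \<Rightarrow> (nat \<Rightarrow> 'r \<Rightarrow> 'a::finite history \<Rightarrow> 'a) \<Rightarrow> bool" where
  "strategy R \<pi> \<longleftrightarrow> prob_space R \<and>
     (\<forall>t. (\<lambda>(u, h). \<pi> t u h) \<in> R \<Otimes>\<^sub>M history_space t \<rightarrow>\<^sub>M count_space UNIV)"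

text \<open>The history produced by the seed \<open>u\<close> and the noise sequence \<open>\<eta>\<close> when the means are \<open>\<mu>\<close>.\<close>

primrec history ::
  "(nat \<Rightarrow> 'r \<Rightarrow> 'a history \<Rightarrow> 'a) \<Rightarrow> ('a \<Rightarrow> real) \<Rightarrow> 'r \<Rightarrow> (nat \<Rightarrow> real) \<Rightarrow> nat \<Rightarrow> 'a history" where
  "history \<pi> \<mu> u \<eta> 0 = (\<lambda>_. undefined)"
| "history \<pi> \<mu> u \<eta> (Suc t) =
     (let h = history \<pi> \<mu> u \<eta> t; a = \<pi> t u h in h(t := (a, \<mu> a + \<eta> t)))"

definition chosen_arm ::
  "(nat \<Rightarrow> 'r \<Rightarrow> 'a history \<Rightarrow> 'a) \<Rightarrow> ('a \<Rightarrow> real) \<Rightarrow> 'r \<Rightarrow> (nat \<Rightarrow> real) \<Rightarrow> nat \<Rightarrow> 'a" where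
  "chosen_arm \<pi> \<mu> u \<eta> t = \<pi> t u (history \<pi> \<mu> u \<eta> t)"

abbreviation std_gaussian :: "real measure" where
  "std_gaussian \<equiv> density lborel std_normal_density"

definition sample_space :: "'r measure \<Rightarrow> nat \<Rightarrow> ('r \<times> (nat \<Rightarrow> real)) measure" where
  "sample_space R n = R \<Otimes>\<^sub>M (\<Pi>\<^sub>M t\<in>{..<n}. std_gaussian)"

definition pseudo_regret ::
  "'r measure \<Rightarrow> (nat \<Rightarrow> 'r \<Rightarrow> 'a::finite history \<Rightarrow> 'a) \<Rightarrow> ('a \<Rightarrow> real) \<Rightarrow> nat \<Rightarrow> real" where
  "pseudo_regret R \<pi> \<mu> n =
     real n * Max (range \<mu>) -
     (LINT (u, \<eta>)|sample_space R n. (\<Sum>t<n. \<mu> (chosen_arm \<pi> \<mu> u \<eta> t)))"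

definition gap :: "('a::finite \<Rightarrow> real) \<Rightarrow> 'a \<Rightarrow> real" where
  "gap \<mu> i = Max (range \<mu>) - \<mu> i"

text \<open>
  The case distinction is needed: division by zero yields \<open>0\<close> in HOL, whereas a summand with
  \<open>gap \<mu> j = 0\<close> has to be \<open>1\<close>.
\<close>

definition k_half :: "('a::finite \<Rightarrow> real) \<Rightarrow> 'a \<Rightarrow> real" where
  "k_half \<mu> i = (\<Sum>j\<in>UNIV. if gap \<mu> j = 0 then 1 else min 1 (gap \<mu> i / gap \<mu> j))"

text \<open>
  For a strategy, the integral in \<open>pseudo_regret\<close> is a genuine expectation and not the default
  value \<open>0\<close> of a non-integrable function.
\<close>

lemma prob_space_sample_space:
  assumes "prob_space R"
  shows "prob_space (sample_space R n)"
proof -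
  have "prob_space std_gaussian"
    by (rule prob_space_normal_density) simp
  then have "prob_space (\<Pi>\<^sub>M t\<in>{..<n}. std_gaussian)"
    by (rule prob_space_PiM)
  with assms show ?thesis
    unfolding sample_space_def by (rule prob_space_pair)
qed

lemma measurable_chosen_arm_aux:
  assumes "strategy R \<pi>"
    and "(\<lambda>(u, \<eta>). history \<pi> \<mu> u \<eta> t) \<in> sample_space R n \<rightarrow>\<^sub>M history_space t"
  shows "(\<lambda>(u, \<eta>). chosen_arm \<pi> \<mu> u \<eta> t) \<in> sample_space R n \<rightarrow>\<^sub>M count_space UNIV"
proof -
  have 1: "(\<lambda>x. (fst x, (\<lambda>(u, \<eta>). history \<pi> \<mu> u \<eta> t) x))
      \<in> sample_space R n \<rightarrow>\<^sub>M R \<Otimes>\<^sub>M history_space t"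
    by (rule measurable_Pair[OF _ assms(2)]) (simp add: sample_space_def)
  have 2: "(\<lambda>(u, h). \<pi> t u h) \<in> R \<Otimes>\<^sub>M history_space t \<rightarrow>\<^sub>M count_space UNIV"
    using assms(1) by (simp add: strategy_def)
  show ?thesis
    using measurable_compose[OF 1 2] by (simp add: chosen_arm_def case_prod_beta')
qed

lemma measurable_history:
  assumes "strategy R \<pi>" and "t \<le> n"
  shows "(\<lambda>(u, \<eta>). history \<pi> \<mu> u \<eta> t) \<in> sample_space R n \<rightarrow>\<^sub>M history_space t"
  using assms(2)
proof (induction t)
  case 0
  show ?case by (simp add: case_prod_beta')
next
  case (Suc t)
  let ?S = "sample_space R n" and ?A = "\<lambda>x. chosen_arm \<pi> \<mu> (fst x) (snd x) t"
  have IH: "(\<lambda>x. history \<pi> \<mu> (fst x) (snd x) t) \<in> ?S \<rightarrow>\<^sub>M history_space t"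
    using Suc by (simp add: case_prod_beta')
  have a: "?A \<in> ?S \<rightarrow>\<^sub>M count_space UNIV"
    using measurable_chosen_arm_aux[OF assms(1), of \<mu> t n] IH by (simp add: case_prod_beta')
  have "(\<lambda>x. snd x t) \<in> ?S \<rightarrow>\<^sub>M std_gaussian"
    unfolding sample_space_def
    by (rule measurable_compose[OF measurable_snd measurable_component_singleton])
       (use Suc in simp)
  then have e: "(\<lambda>x. snd x t) \<in> borel_measurable ?S" by simp
  have m: "(\<lambda>x. \<mu> (?A x)) \<in> borel_measurable ?S"
    by (rule measurable_compose[OF a]) simp
  have "(\<lambda>x. (?A x, \<mu> (?A x) + snd x t)) \<in> ?S \<rightarrow>\<^sub>M count_space UNIV \<Otimes>\<^sub>M borel"
    using a e m by measurable
  then have "(\<lambda>x. (history \<pi> \<mu> (fst x) (snd x) t)(t := (?A x, \<mu> (?A x) + snd x t)))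
      \<in> ?S \<rightarrow>\<^sub>M history_space (Suc t)"
    by (intro measurable_fun_upd[where J = "{..<t}"] IH) auto
  then show ?case
    by (simp add: case_prod_beta' Let_def chosen_arm_def fun_upd_def)
qed

lemma measurable_chosen_arm:
  assumes "strategy R \<pi>" and "t \<le> n"
  shows "(\<lambda>(u, \<eta>). chosen_arm \<pi> \<mu> u \<eta> t) \<in> sample_space R n \<rightarrow>\<^sub>M count_space UNIV"
  using measurable_chosen_arm_aux[OF assms(1) measurable_history[OF assms]] .

lemma integrable_sum_mean_chosen_arm:
  fixes \<mu> :: "'a::finite \<Rightarrow> real"
  assumes "strategy R \<pi>"
  shows "integrable (sample_space R n) (\<lambda>(u, \<eta>). \<Sum>t<n. \<mu> (chosen_arm \<pi> \<mu> u \<eta> t))"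
proof -
  interpret prob_space "sample_space R n"
    using assms by (intro prob_space_sample_space) (simp add: strategy_def)
  have "integrable (sample_space R n) (\<lambda>x. \<mu> (chosen_arm \<pi> \<mu> (fst x) (snd x) t))"
    if "t < n" for t
  proof (rule integrable_const_bound)
    show "AE x in sample_space R n.
        norm (\<mu> (chosen_arm \<pi> \<mu> (fst x) (snd x) t)) \<le> Max (range (\<lambda>a. \<bar>\<mu> a\<bar>))"
      by (intro AE_I2) (auto intro!: Max_ge)
    show "(\<lambda>x. \<mu> (chosen_arm \<pi> \<mu> (fst x) (snd x) t)) \<in> borel_measurable (sample_space R n)"
      using measurable_compose[OF measurable_chosen_arm[OF assms, of t n \<mu>], of \<mu> borel] that
      by (simp add: case_prod_beta')
  qed
  then show ?thesis
    by (auto simp: case_prod_beta')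
qed

end

theory Submission
  imports Defs
begin

text \<open>
  If the first alternative fails, some suboptimal arm \<open>i\<close> is pulled \<open>T < ln x / (4 * (gap \<mu> i)\<^sup>2)\<close>
  times on average, where \<open>x = n * (gap \<mu> i)\<^sup>2 / (k_half \<mu> i * ln n)\<close>. Raising its mean by
  \<open>2 * gap \<mu> i\<close> makes it optimal by a margin \<open>gap \<mu> i\<close>, while the relative entropy between the two
  environments is only \<open>2 * (gap \<mu> i)\<^sup>2 * T < ln x / 2\<close>. By the Bretagnolle--Huber inequality the
  strategy then plays arms other than \<open>i\<close> at least \<open>n / (2 * sqrt x) - T\<close> times in the modified
  environment, each time losing \<open>gap \<mu> i\<close> or more. The logarithms in the second alternative are at
  most \<open>ln (2 * n / ln n)\<close>, and their weights add up to at most \<open>(k_half \<mu> i - 1) / gap \<mu> i\<close>. This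
  settles \<open>n \<ge> 5\<close>; for smaller \<open>n\<close> the hypothesis on the largest gap leaves only two arms.
\<close>

section \<open>Dependence of histories on past noise\<close>

lemma history_cong:
  assumes "\<And>s. s < t \<Longrightarrow> \<eta> s = \<eta>' s"
  shows "history \<pi> \<mu> u \<eta> t = history \<pi> \<mu> u \<eta>' t"
  using assms by (induction t) (auto simp: Let_def)

lemma history_fun_upd: "t \<le> m \<Longrightarrow> history \<pi> \<mu> u (\<eta>(m := y)) t = history \<pi> \<mu> u \<eta> t"
  by (rule history_cong) simp

text \<open>The case \<open>t = m\<close> matters: an arm is chosen before the noise of its own
  round is seen, so it is unaffected by that noise.\<close>

lemma chosen_arm_fun_upd: "t \<le> m \<Longrightarrow> chosen_arm \<pi> \<mu> u (\<eta>(m := y)) t = chosen_arm \<pi> \<mu> u \<eta> t"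
  by (simp add: chosen_arm_def history_fun_upd)

text \<open>This makes pull counts functions of the history alone, so that a change of measure for
  histories applies to them.\<close>

lemma fst_history: "s < t \<Longrightarrow> fst (history \<pi> \<mu> u \<eta> t s) = chosen_arm \<pi> \<mu> u \<eta> s"
  by (induction t) (auto simp: Let_def chosen_arm_def less_Suc_eq)

section \<open>Gaussian shifts and integration over the last round\<close>

lemma prob_space_std_gaussian: "prob_space std_gaussian"
  by (rule prob_space_normal_density) simp

text \<open>Substituting \<open>d + y\<close> for \<open>y\<close> on the right, the exponential
  factor turns the density at \<open>d + y\<close> back into the density at \<open>y\<close>. This
  is the one-round change of measure.\<close>

lemma std_gaussian_shift:
  assumes [measurable]: "f \<in> borel_measurable borel"
  shows "(\<integral>\<^sup>+y. f (d + y) \<partial>std_gaussian)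
    = (\<integral>\<^sup>+y. ennreal (exp (d * y - d\<^sup>2 / 2)) * f y \<partial>std_gaussian)"
proof -
  have "(\<integral>\<^sup>+y. ennreal (exp (d * y - d\<^sup>2 / 2)) * f y \<partial>std_gaussian)
      = (\<integral>\<^sup>+y. ennreal (std_normal_density y) * (ennreal (exp (d * y - d\<^sup>2 / 2)) * f y) \<partial>lborel)"
    by (subst nn_integral_density) auto
  also have "\<dots> = (\<integral>\<^sup>+y. ennreal (std_normal_density (d + 1 * y)) *
      (ennreal (exp (d * (d + 1 * y) - d\<^sup>2 / 2)) * f (d + 1 * y)) \<partial>lborel)"
    by (subst nn_integral_real_affine[where c = 1 and t = d]) auto
  also have "\<dots> = (\<integral>\<^sup>+y. ennreal (std_normal_density y) * f (d + y) \<partial>lborel)"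
  proof (rule nn_integral_cong)
    fix y :: real
    have "std_normal_density (d + y) * exp (d * (d + y) - d\<^sup>2 / 2) = std_normal_density y"
      by (simp add: std_normal_density_def exp_add[symmetric] power2_eq_square field_simps)
    then show "ennreal (std_normal_density (d + 1 * y)) *
        (ennreal (exp (d * (d + 1 * y) - d\<^sup>2 / 2)) * f (d + 1 * y)) =
        ennreal (std_normal_density y) * f (d + y)"
      by (simp add: ennreal_mult[symmetric] mult.assoc[symmetric])
  qed
  also have "\<dots> = (\<integral>\<^sup>+y. f (d + y) \<partial>std_gaussian)"
    by (subst nn_integral_density) auto
  finally show ?thesis by simp
qed

text \<open>Tonelli with the last noise coordinate split off; it supplies the induction over
  rounds.\<close>

lemma nn_integral_sample_space_Suc:
  assumes [measurable]: "F \<in> borel_measurable (sample_space R (Suc n))"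
  shows "(\<integral>\<^sup>+x. F x \<partial>sample_space R (Suc n))
    = (\<integral>\<^sup>+x. (\<integral>\<^sup>+y. F (fst x, (snd x)(n := y)) \<partial>std_gaussian) \<partial>sample_space R n)"
proof -
  let ?P = "\<lambda>n. \<Pi>\<^sub>M t\<in>{..<n::nat}. std_gaussian"
  interpret G: prob_space std_gaussian by (rule prob_space_std_gaussian)
  interpret product_sigma_finite "\<lambda>_::nat. std_gaussian" by standard
  interpret P: sigma_finite_measure "?P m" for m by (rule sigma_finite) simp
  have ins: "{..<Suc n} = insert n {..<n}" by auto
  have F[measurable]: "F \<in> borel_measurable (R \<Otimes>\<^sub>M (\<Pi>\<^sub>M t\<in>insert n {..<n}. std_gaussian))"
    using assms by (simp add: sample_space_def ins)
  have upd: "(\<lambda>p. (fst (fst p), (snd (fst p))(n := snd p)))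
      \<in> (R \<Otimes>\<^sub>M ?P n) \<Otimes>\<^sub>M std_gaussian \<rightarrow>\<^sub>M R \<Otimes>\<^sub>M (\<Pi>\<^sub>M t\<in>insert n {..<n}. std_gaussian)"
    by (intro measurable_Pair measurable_fun_upd[where J = "{..<n}"]) auto
  have Fu: "(\<lambda>p. F (fst (fst p), (snd (fst p))(n := snd p)))
      \<in> borel_measurable ((R \<Otimes>\<^sub>M ?P n) \<Otimes>\<^sub>M std_gaussian)"
    using measurable_compose[OF upd F] .
  have "(\<integral>\<^sup>+x. F x \<partial>sample_space R (Suc n)) = (\<integral>\<^sup>+u. (\<integral>\<^sup>+\<eta>. F (u, \<eta>) \<partial>?P (Suc n)) \<partial>R)"
    unfolding sample_space_def
    by (rule P.nn_integral_fst[symmetric]) (use assms in \<open>simp add: sample_space_def\<close>)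
  also have "\<dots> = (\<integral>\<^sup>+u. (\<integral>\<^sup>+\<eta>. (\<integral>\<^sup>+y. F (u, \<eta>(n := y)) \<partial>std_gaussian) \<partial>?P n) \<partial>R)"
  proof (rule nn_integral_cong)
    fix u assume u: "u \<in> space R"
    have "(\<lambda>\<eta>. F (u, \<eta>)) \<in> borel_measurable (\<Pi>\<^sub>M t\<in>insert n {..<n}. std_gaussian)"
      using u by measurable
    then show "(\<integral>\<^sup>+\<eta>. F (u, \<eta>) \<partial>?P (Suc n)) =
        (\<integral>\<^sup>+\<eta>. (\<integral>\<^sup>+y. F (u, \<eta>(n := y)) \<partial>std_gaussian) \<partial>?P n)"
      unfolding ins by (intro product_nn_integral_insert) auto
  qed
  also have "\<dots> = (\<integral>\<^sup>+x. (\<integral>\<^sup>+y. F (fst x, (snd x)(n := y)) \<partial>std_gaussian) \<partial>sample_space R n)"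
    unfolding sample_space_def
    by (subst P.nn_integral_fst[symmetric]) (use G.borel_measurable_nn_integral_fst[OF Fu] in auto)
  finally show ?thesis .
qed

section \<open>Likelihood ratio and change of measure\<close>

text \<open>The logarithm of the density of the history under \<open>\<nu>\<close> relative to the
  history under \<open>\<mu>\<close>, written in the noise of the \<open>\<mu>\<close> run: at the
  reward \<open>\<mu> a + y\<close>, the unit-variance Gaussians centred at \<open>\<nu> a\<close>
  and \<open>\<mu> a\<close> have log ratio \<open>d * y - d\<^sup>2 / 2\<close>.\<close>

definition log_likelihood_ratio ::
  "(nat \<Rightarrow> 'r \<Rightarrow> 'a history \<Rightarrow> 'a) \<Rightarrow> ('a \<Rightarrow> real) \<Rightarrow> ('a \<Rightarrow> real) \<Rightarrow> nat \<Rightarrow> 'r \<times> (nat \<Rightarrow> real) \<Rightarrow> real"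
  where "log_likelihood_ratio \<pi> \<mu> \<nu> n x = (\<Sum>t<n.
    let a = chosen_arm \<pi> \<mu> (fst x) (snd x) t; d = \<nu> a - \<mu> a in d * snd x t - d\<^sup>2 / 2)"

lemma measurable_noise:
  assumes "t < n"
  shows "(\<lambda>x. snd x t) \<in> borel_measurable (sample_space R n)"
proof -
  have "(\<lambda>x. snd x t) \<in> sample_space R n \<rightarrow>\<^sub>M std_gaussian"
    unfolding sample_space_def
    by (rule measurable_compose[OF measurable_snd measurable_component_singleton]) (use assms in simp)
  then show ?thesis by simp
qed

lemma measurable_fun_chosen_arm:
  fixes f :: "'a::finite \<Rightarrow> real"
  assumes "strategy R \<pi>" "t \<le> n"
  shows "(\<lambda>x. f (chosen_arm \<pi> \<mu> (fst x) (snd x) t)) \<in> borel_measurable (sample_space R n)"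
  using measurable_compose[OF measurable_chosen_arm[OF assms], of f borel \<mu>]
  by (simp add: case_prod_beta')

lemma measurable_log_likelihood_ratio:
  fixes \<mu> :: "'a::finite \<Rightarrow> real"
  assumes "strategy R \<pi>"
  shows "log_likelihood_ratio \<pi> \<mu> \<nu> n \<in> borel_measurable (sample_space R n)"
proof -
  have [measurable]: "(\<lambda>x. \<nu> (chosen_arm \<pi> \<mu> (fst x) (snd x) t) - \<mu> (chosen_arm \<pi> \<mu> (fst x) (snd x) t))
      \<in> borel_measurable (sample_space R n)" if "t < n" for t
    using measurable_fun_chosen_arm[OF assms, of t n "\<lambda>a. \<nu> a - \<mu> a"] that by simp
  note [measurable] = measurable_noise
  show ?thesis
    unfolding log_likelihood_ratio_def[abs_def] Let_def by measurable
qed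

text \<open>Both environments are driven by the same seed and noise, so passing from \<open>\<mu>\<close> to \<open>\<nu>\<close> amounts
  to shifting each noise variable by an amount which depends only on the past.\<close>

lemma history_change_of_measure:
  fixes \<mu> \<nu> :: "'a::finite \<Rightarrow> real" and f :: "'r \<times> 'a history \<Rightarrow> ennreal"
  assumes st: "strategy R \<pi>"
    and f: "f \<in> borel_measurable (R \<Otimes>\<^sub>M history_space n)"
  shows "(\<integral>\<^sup>+x. f (fst x, history \<pi> \<nu> (fst x) (snd x) n) \<partial>sample_space R n)
    = (\<integral>\<^sup>+x. ennreal (exp (log_likelihood_ratio \<pi> \<mu> \<nu> n x)) *
          f (fst x, history \<pi> \<mu> (fst x) (snd x) n) \<partial>sample_space R n)"
  using f
proof (induction n arbitrary: f)
  case 0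
  show ?case by (simp add: log_likelihood_ratio_def)
next
  case (Suc n)
  interpret G: prob_space std_gaussian by (rule prob_space_std_gaussian)
  let ?S = "sample_space R" and ?LR = "log_likelihood_ratio \<pi> \<mu> \<nu>"
  \<comment> \<open>Round \<open>n\<close> under means \<open>\<xi>\<close> with noise
    \<open>y\<close>, appended to the seed and history \<open>p\<close>.\<close>
  let ?ext = "\<lambda>\<xi> p y. (fst p, (snd p)(n := (\<pi> n (fst p) (snd p), \<xi> (\<pi> n (fst p) (snd p)) + y)))"
  have arm: "(\<lambda>p. \<pi> n (fst p) (snd p)) \<in> R \<Otimes>\<^sub>M history_space n \<rightarrow>\<^sub>M count_space UNIV"
    using st by (simp add: strategy_def case_prod_beta')
  have hist: "(\<lambda>x. (fst x, history \<pi> \<xi> (fst x) (snd x) m)) \<in> ?S m \<rightarrow>\<^sub>M R \<Otimes>\<^sub>M history_space m" for \<xi> m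
    using measurable_history[OF st, of m m \<xi>]
    by (intro measurable_Pair) (auto simp: sample_space_def case_prod_beta')
  have step: "(\<lambda>q. ?ext \<xi> (fst q) (snd q))
      \<in> (R \<Otimes>\<^sub>M history_space n) \<Otimes>\<^sub>M std_gaussian \<rightarrow>\<^sub>M R \<Otimes>\<^sub>M history_space (Suc n)" for \<xi>
  proof (intro measurable_Pair measurable_fun_upd[where J = "{..<n}"])
    have a: "(\<lambda>q. \<pi> n (fst (fst q)) (snd (fst q)))
        \<in> (R \<Otimes>\<^sub>M history_space n) \<Otimes>\<^sub>M std_gaussian \<rightarrow>\<^sub>M count_space UNIV"
      by (rule measurable_compose[OF measurable_fst arm])
    show "(\<lambda>q. \<pi> n (fst (fst q)) (snd (fst q)))
        \<in> (R \<Otimes>\<^sub>M history_space n) \<Otimes>\<^sub>M std_gaussian \<rightarrow>\<^sub>M count_space UNIV" by (rule a)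
    have [measurable]: "(\<lambda>q. \<xi> (\<pi> n (fst (fst q)) (snd (fst q))))
        \<in> borel_measurable ((R \<Otimes>\<^sub>M history_space n) \<Otimes>\<^sub>M std_gaussian)"
      by (rule measurable_compose[OF a]) simp
    have [measurable]: "snd \<in> borel_measurable ((R \<Otimes>\<^sub>M history_space n) \<Otimes>\<^sub>M std_gaussian)"
      by (metis measurable_snd measurable_lborel1 measurable_density_eq2)
    show "(\<lambda>q. \<xi> (\<pi> n (fst (fst q)) (snd (fst q))) + snd q)
        \<in> borel_measurable ((R \<Otimes>\<^sub>M history_space n) \<Otimes>\<^sub>M std_gaussian)"
      by measurable
  qed auto
  \<comment> \<open>Integrating out the noise of round \<open>n\<close> leaves a function of the
    shorter history, to which the induction hypothesis applies; hence the induction is over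
    arbitrary \<open>f\<close>.\<close>
  define g where "g p = (\<integral>\<^sup>+y. f (?ext \<nu> p y) \<partial>std_gaussian)" for p
  have g: "g \<in> borel_measurable (R \<Otimes>\<^sub>M history_space n)"
    unfolding g_def
    using G.borel_measurable_nn_integral_fst[OF measurable_compose[OF step Suc.prems, of \<nu>]] by simp
  \<comment> \<open>For a fixed past \<open>p\<close> both environments pull the same arm, so their
    rewards differ by a constant and the one-round shift applies.\<close>
  have g_eq: "g p = (\<integral>\<^sup>+y. ennreal (exp (let d = \<nu> (\<pi> n (fst p) (snd p)) - \<mu> (\<pi> n (fst p) (snd p))
      in d * y - d\<^sup>2 / 2)) * f (?ext \<mu> p y) \<partial>std_gaussian)"
    if p: "p \<in> space (R \<Otimes>\<^sub>M history_space n)" for p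
  proof -
    let ?a = "\<pi> n (fst p) (snd p)"
    have "(\<lambda>y. (p, y)) \<in> borel \<rightarrow>\<^sub>M (R \<Otimes>\<^sub>M history_space n) \<Otimes>\<^sub>M std_gaussian"
      using p by (intro measurable_Pair) auto
    then have "(\<lambda>y. f (?ext \<mu> p y)) \<in> borel_measurable borel"
      using measurable_compose[OF _ measurable_compose[OF step Suc.prems, of \<mu>]] by fastforce
    from std_gaussian_shift[OF this, of "\<nu> ?a - \<mu> ?a"] show ?thesis
      by (simp add: g_def Let_def algebra_simps)
  qed
  have hSuc: "(fst x, history \<pi> \<xi> (fst x) ((snd x)(n := y)) (Suc n))
      = ?ext \<xi> (fst x, history \<pi> \<xi> (fst x) (snd x) n) y" for \<xi> x y
    by (simp add: Let_def history_fun_upd)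
  have LRSuc: "?LR (Suc n) (fst x, (snd x)(n := y)) = ?LR n x +
      (let a = chosen_arm \<pi> \<mu> (fst x) (snd x) n; d = \<nu> a - \<mu> a in d * y - d\<^sup>2 / 2)" for x y
    by (simp add: log_likelihood_ratio_def chosen_arm_fun_upd)
  have sp: "(fst x, history \<pi> \<mu> (fst x) (snd x) n) \<in> space (R \<Otimes>\<^sub>M history_space n)"
    if "x \<in> space (?S n)" for x
    using measurable_space[OF hist that] .
  have "(\<integral>\<^sup>+x. f (fst x, history \<pi> \<nu> (fst x) (snd x) (Suc n)) \<partial>?S (Suc n))
      = (\<integral>\<^sup>+x. g (fst x, history \<pi> \<nu> (fst x) (snd x) n) \<partial>?S n)"
    by (subst nn_integral_sample_space_Suc)
      (use measurable_compose[OF hist Suc.prems, of \<nu>] in \<open>auto simp: history_fun_upd g_def Let_def\<close>)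
  also have "\<dots> = (\<integral>\<^sup>+x. ennreal (exp (?LR n x)) * g (fst x, history \<pi> \<mu> (fst x) (snd x) n) \<partial>?S n)"
    by (rule Suc.IH[OF g])
  also have "\<dots> = (\<integral>\<^sup>+x. (\<integral>\<^sup>+y. ennreal (exp (?LR (Suc n) (fst x, (snd x)(n := y)))) *
      f (fst x, history \<pi> \<mu> (fst x) ((snd x)(n := y)) (Suc n)) \<partial>std_gaussian) \<partial>?S n)"
  proof (rule nn_integral_cong)
    fix x assume x: "x \<in> space (?S n)"
    let ?p = "(fst x, history \<pi> \<mu> (fst x) (snd x) n)"
    let ?a = "chosen_arm \<pi> \<mu> (fst x) (snd x) n"
    let ?l = "\<lambda>y. let d = \<nu> ?a - \<mu> ?a in d * y - d\<^sup>2 / 2"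
    have [measurable]: "(\<lambda>y. f (?ext \<mu> ?p y)) \<in> borel_measurable borel"
      using measurable_compose[OF measurable_Pair1'[OF sp[OF x]] measurable_compose[OF step Suc.prems, of \<mu>]]
      by simp
    have "(\<lambda>y. ennreal (exp (?l y)) * f (?ext \<mu> ?p y)) \<in> borel_measurable borel"
      unfolding Let_def by measurable
    then have "ennreal (exp (?LR n x)) * (\<integral>\<^sup>+y. ennreal (exp (?l y)) * f (?ext \<mu> ?p y) \<partial>std_gaussian)
        = (\<integral>\<^sup>+y. ennreal (exp (?LR n x)) * (ennreal (exp (?l y)) * f (?ext \<mu> ?p y)) \<partial>std_gaussian)"
      by (intro nn_integral_cmult[symmetric]) simp
    then show "ennreal (exp (?LR n x)) * g ?p =
      (\<integral>\<^sup>+y. ennreal (exp (?LR (Suc n) (fst x, (snd x)(n := y)))) *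
        f (fst x, history \<pi> \<mu> (fst x) ((snd x)(n := y)) (Suc n)) \<partial>std_gaussian)"
      unfolding g_eq[OF sp[OF x]] hSuc LRSuc exp_add
      by (simp add: ennreal_mult mult.assoc chosen_arm_def Let_def)
  qed
  also have "\<dots> = (\<integral>\<^sup>+x. ennreal (exp (?LR (Suc n) x)) *
      f (fst x, history \<pi> \<mu> (fst x) (snd x) (Suc n)) \<partial>?S (Suc n))"
  proof (subst nn_integral_sample_space_Suc)
    note [measurable] = measurable_compose[OF hist Suc.prems, of \<mu>] measurable_log_likelihood_ratio[OF st]
    show "(\<lambda>x. ennreal (exp (?LR (Suc n) x)) * f (fst x, history \<pi> \<mu> (fst x) (snd x) (Suc n)))
        \<in> borel_measurable (?S (Suc n))"
      by measurable
  qed simp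
  finally show ?case .
qed

section \<open>Moments and integrability of the noise\<close>

lemma nn_integral_noise:
  assumes "prob_space R" "t < n" and [measurable]: "f \<in> borel_measurable borel"
  shows "(\<integral>\<^sup>+x. f (snd x t) \<partial>sample_space R n) = (\<integral>\<^sup>+y. f y \<partial>std_gaussian)"
proof -
  let ?P = "\<Pi>\<^sub>M t\<in>{..<n}. std_gaussian"
  interpret R: prob_space R by fact
  interpret P: prob_space ?P by (intro prob_space_PiM prob_space_std_gaussian)
  have *: "distr ?P std_gaussian (\<lambda>\<eta>. \<eta> t) = std_gaussian"
    using assms(2) by (intro distr_PiM_component prob_space_std_gaussian) auto
  have m: "(\<lambda>\<eta>. \<eta> t) \<in> ?P \<rightarrow>\<^sub>M std_gaussian"
    using assms(2) by (intro measurable_component_singleton) auto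
  have "(\<integral>\<^sup>+x. f (snd x t) \<partial>sample_space R n) = (\<integral>\<^sup>+u. (\<integral>\<^sup>+\<eta>. f (\<eta> t) \<partial>?P) \<partial>R)"
    using measurable_compose[OF measurable_noise[OF assms(2)] assms(3), of R]
    unfolding sample_space_def by (subst P.nn_integral_fst[symmetric]) auto
  also have "\<dots> = (\<integral>\<^sup>+\<eta>. f (\<eta> t) \<partial>?P)"
    by (simp add: R.emeasure_space_1)
  also have "\<dots> = (\<integral>\<^sup>+y. f y \<partial>distr ?P std_gaussian (\<lambda>\<eta>. \<eta> t))"
    using m by (subst nn_integral_distr) auto
  finally show ?thesis by (simp add: *)
qed

lemma integrable_noise:
  assumes "prob_space R" "t < n"
  shows "integrable (sample_space R n) (\<lambda>x. snd x t)"
proof (rule integrableI_bounded)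
  have "integrable std_gaussian (\<lambda>y. y)"
    using integrable_std_normal_distribution_moment[of 1] by simp
  then show "(\<integral>\<^sup>+x. ennreal (norm (snd x t)) \<partial>sample_space R n) < \<infinity>"
    using nn_integral_noise[OF assms, of "\<lambda>y. ennreal (norm y)"]
    by (simp add: integrable_iff_bounded)
qed (rule measurable_noise[OF assms(2)])

lemma integrable_fun_chosen_arm_mult:
  fixes f :: "'a::finite \<Rightarrow> real" and g :: "'r \<times> (nat \<Rightarrow> real) \<Rightarrow> real"
  assumes "strategy R \<pi>" "t \<le> n" "integrable (sample_space R n) g"
  shows "integrable (sample_space R n) (\<lambda>x. f (chosen_arm \<pi> \<mu> (fst x) (snd x) t) * g x)"
proof (rule Bochner_Integration.integrable_bound)
  show "integrable (sample_space R n) (\<lambda>x. Max (range (\<lambda>a. \<bar>f a\<bar>)) * g x)"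
    using assms(3) by simp
  show "(\<lambda>x. f (chosen_arm \<pi> \<mu> (fst x) (snd x) t) * g x) \<in> borel_measurable (sample_space R n)"
    using measurable_fun_chosen_arm[OF assms(1,2)] assms(3) by measurable
  have "\<bar>f a\<bar> \<le> \<bar>Max (range (\<lambda>a. \<bar>f a\<bar>))\<bar>" for a
    by (rule order_trans[OF Max_ge abs_ge_self]) auto
  then show "AE x in sample_space R n. norm (f (chosen_arm \<pi> \<mu> (fst x) (snd x) t) * g x)
      \<le> norm (Max (range (\<lambda>a. \<bar>f a\<bar>)) * g x)"
    by (intro AE_I2) (auto simp: abs_mult intro: mult_right_mono)
qed

lemma integrable_fun_chosen_arm:
  fixes f :: "'a::finite \<Rightarrow> real"
  assumes "strategy R \<pi>" "t \<le> n"
  shows "integrable (sample_space R n) (\<lambda>x. f (chosen_arm \<pi> \<mu> (fst x) (snd x) t))"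
proof -
  interpret prob_space "sample_space R n"
    using assms by (intro prob_space_sample_space) (simp add: strategy_def)
  show ?thesis
    using integrable_fun_chosen_arm_mult[OF assms, of "\<lambda>_. 1"] by simp
qed

text \<open>The arm of round \<open>t\<close> is constant in noise coordinate \<open>t\<close>;
  integrating that coordinate first leaves the mean of a standard Gaussian.\<close>

lemma expectation_fun_chosen_arm_noise:
  fixes f :: "'a::finite \<Rightarrow> real"
  assumes st: "strategy R \<pi>" and t: "t < n"
  shows "(LINT x|sample_space R n. f (chosen_arm \<pi> \<mu> (fst x) (snd x) t) * snd x t) = 0"
proof -
  let ?P = "\<Pi>\<^sub>M t\<in>{..<n}. std_gaussian"
  interpret R: prob_space R using st by (simp add: strategy_def)
  interpret G: prob_space std_gaussian by (rule prob_space_std_gaussian)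
  interpret P: prob_space ?P by (intro prob_space_PiM prob_space_std_gaussian)
  interpret RP: pair_sigma_finite R ?P ..
  interpret product_sigma_finite "\<lambda>_::nat. std_gaussian" by standard
  have ins: "{..<n} = insert t ({..<n} - {t})" using t by auto
  have mean: "(LINT y|std_gaussian. y) = 0"
    using integral_std_normal_distribution_moment_odd[of 1] by simp
  \<comment> \<open>A section that is not integrable has Bochner integral 0 by convention, so the
    value is 0 for every seed.\<close>
  have inner: "(LINT \<eta>|?P. f (chosen_arm \<pi> \<mu> u \<eta> t) * \<eta> t) = 0" for u
  proof (cases "integrable ?P (\<lambda>\<eta>. f (chosen_arm \<pi> \<mu> u \<eta> t) * \<eta> t)")
    case True
    then show ?thesis
      using ins by (subst ins, subst product_integral_insert) (auto simp: chosen_arm_fun_upd mean)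
  qed (rule not_integrable_integral_eq)
  have "integrable (sample_space R n) (\<lambda>x. f (chosen_arm \<pi> \<mu> (fst x) (snd x) t) * snd x t)"
    using integrable_fun_chosen_arm_mult[OF st _ integrable_noise[OF R.prob_space_axioms t]] t by simp
  from RP.integral_fst'[OF this[unfolded sample_space_def]] show ?thesis
    by (simp add: sample_space_def inner)
qed

section \<open>Expected pulls and the regret decomposition\<close>

definition expected_pulls ::
  "'r measure \<Rightarrow> (nat \<Rightarrow> 'r \<Rightarrow> 'a history \<Rightarrow> 'a) \<Rightarrow> ('a \<Rightarrow> real) \<Rightarrow> nat \<Rightarrow> 'a \<Rightarrow> real" where
  "expected_pulls R \<pi> \<mu> n i =
    (LINT x|sample_space R n. (\<Sum>t<n. of_bool (chosen_arm \<pi> \<mu> (fst x) (snd x) t = i)))"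

lemma expected_pulls_nonneg: "expected_pulls R \<pi> \<mu> n i \<ge> 0"
  unfolding expected_pulls_def by (intro integral_nonneg_AE AE_I2 sum_nonneg) auto

text \<open>Regroups the rounds by arm. With \<open>f\<close> constantly 1, the means, or half the
  squared mean differences, it yields the total count, the regret and the relative entropy.\<close>

lemma sum_expected_pulls_mult:
  fixes f :: "'a::finite \<Rightarrow> real"
  assumes "strategy R \<pi>"
  shows "(\<Sum>i\<in>UNIV. f i * expected_pulls R \<pi> \<mu> n i) =
    (LINT x|sample_space R n. (\<Sum>t<n. f (chosen_arm \<pi> \<mu> (fst x) (snd x) t)))"
proof -
  let ?S = "sample_space R n" and ?A = "\<lambda>x. chosen_arm \<pi> \<mu> (fst x) (snd x)"
  have int: "integrable ?S (\<lambda>x. \<Sum>t<n. of_bool (?A x t = i) :: real)" for i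
    by (intro Bochner_Integration.integrable_sum)
      (use integrable_fun_chosen_arm[OF assms, of _ n "\<lambda>a. of_bool (a = i)"] in auto)
  have "(\<Sum>i\<in>UNIV. f i * expected_pulls R \<pi> \<mu> n i)
      = (LINT x|?S. (\<Sum>i\<in>UNIV. f i * (\<Sum>t<n. of_bool (?A x t = i))))"
    unfolding expected_pulls_def using int by (subst Bochner_Integration.integral_sum) auto
  also have "\<dots> = (LINT x|?S. (\<Sum>t<n. f (?A x t)))"
  proof (rule Bochner_Integration.integral_cong)
    fix x
    have "(\<Sum>i\<in>UNIV. f i * (\<Sum>t<n. of_bool (?A x t = i)))
        = (\<Sum>t<n. \<Sum>i\<in>UNIV. f i * of_bool (?A x t = i))"
      unfolding sum_distrib_left by (rule sum.swap)
    also have "\<dots> = (\<Sum>t<n. f (?A x t))"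
      by (intro sum.cong refl) (simp add: of_bool_def if_distrib cong: if_cong)
    finally show "(\<Sum>i\<in>UNIV. f i * (\<Sum>t<n. of_bool (?A x t = i))) = (\<Sum>t<n. f (?A x t))" .
  qed simp
  finally show ?thesis .
qed

lemma sum_expected_pulls:
  fixes \<pi> :: "nat \<Rightarrow> 'r \<Rightarrow> 'a::finite history \<Rightarrow> 'a"
  assumes "strategy R \<pi>"
  shows "(\<Sum>i\<in>UNIV. expected_pulls R \<pi> \<mu> n i) = n"
proof -
  interpret prob_space "sample_space R n"
    using assms by (intro prob_space_sample_space) (simp add: strategy_def)
  show ?thesis
    using sum_expected_pulls_mult[OF assms, of "\<lambda>_. 1" \<mu> n] by (simp add: prob_space)
qed

lemma pseudo_regret_eq_sum:
  assumes "strategy R \<pi>"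
  shows "pseudo_regret R \<pi> \<mu> n = (\<Sum>i\<in>UNIV. gap \<mu> i * expected_pulls R \<pi> \<mu> n i)"
proof -
  have "(\<Sum>i\<in>UNIV. gap \<mu> i * expected_pulls R \<pi> \<mu> n i)
      = Max (range \<mu>) * (\<Sum>i\<in>UNIV. expected_pulls R \<pi> \<mu> n i)
        - (\<Sum>i\<in>UNIV. \<mu> i * expected_pulls R \<pi> \<mu> n i)"
    by (simp add: gap_def left_diff_distrib sum_subtractf sum_distrib_left)
  then show ?thesis
    by (simp add: pseudo_regret_def sum_expected_pulls_mult[OF assms] sum_expected_pulls[OF assms]
        case_prod_beta' mult.commute)
qed

section \<open>Relative entropy and the Bretagnolle--Huber inequality\<close>

lemma integrable_log_likelihood_ratio_summand:
  fixes \<mu> \<nu> :: "'a::finite \<Rightarrow> real"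
  assumes "strategy R \<pi>" "t < n"
  shows "integrable (sample_space R n) (\<lambda>x. let a = chosen_arm \<pi> \<mu> (fst x) (snd x) t; d = \<nu> a - \<mu> a
    in d * snd x t - d\<^sup>2 / 2)"
proof -
  have "prob_space R" using assms(1) by (simp add: strategy_def)
  then show ?thesis
    using integrable_fun_chosen_arm_mult[OF assms(1) _ integrable_noise, of t n t "\<lambda>a. \<nu> a - \<mu> a" \<mu>]
      integrable_fun_chosen_arm[OF assms(1), of t n "\<lambda>a. (\<nu> a - \<mu> a)\<^sup>2 / 2" \<mu>] assms(2)
    by (simp add: Let_def)
qed

lemma integrable_log_likelihood_ratio:
  fixes \<mu> \<nu> :: "'a::finite \<Rightarrow> real"
  assumes "strategy R \<pi>"
  shows "integrable (sample_space R n) (log_likelihood_ratio \<pi> \<mu> \<nu> n)"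
  unfolding log_likelihood_ratio_def[abs_def]
  using integrable_log_likelihood_ratio_summand[OF assms] by auto

text \<open>The noise terms have mean zero, so only the drift \<open>- d\<^sup>2 / 2\<close> of each
  round survives. The result is minus the relative entropy of the \<open>\<mu>\<close> history with
  respect to the \<open>\<nu>\<close> history.\<close>

lemma expectation_log_likelihood_ratio:
  fixes \<mu> \<nu> :: "'a::finite \<Rightarrow> real"
  assumes st: "strategy R \<pi>"
  shows "(LINT x|sample_space R n. log_likelihood_ratio \<pi> \<mu> \<nu> n x)
    = - (\<Sum>i\<in>UNIV. (\<nu> i - \<mu> i)\<^sup>2 / 2 * expected_pulls R \<pi> \<mu> n i)"
proof -
  let ?S = "sample_space R n" and ?A = "\<lambda>t x. chosen_arm \<pi> \<mu> (fst x) (snd x) t"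
  let ?d = "\<lambda>t x. \<nu> (?A t x) - \<mu> (?A t x)"
  have R: "prob_space R" using st by (simp add: strategy_def)
  have i1: "integrable ?S (\<lambda>x. ?d t x * snd x t)" if "t < n" for t
    using integrable_fun_chosen_arm_mult[OF st _ integrable_noise[OF R that], of t "\<lambda>a. \<nu> a - \<mu> a"] that
    by simp
  have i2: "integrable ?S (\<lambda>x. (?d t x)\<^sup>2 / 2)" if "t < n" for t
    using integrable_fun_chosen_arm[OF st, of t n "\<lambda>a. (\<nu> a - \<mu> a)\<^sup>2 / 2"] that by simp
  have "(LINT x|?S. log_likelihood_ratio \<pi> \<mu> \<nu> n x)
      = (\<Sum>t<n. (LINT x|?S. ?d t x * snd x t - (?d t x)\<^sup>2 / 2))"
    unfolding log_likelihood_ratio_def Let_def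
    by (rule Bochner_Integration.integral_sum) (use i1 i2 in auto)
  also have "\<dots> = (\<Sum>t<n. - (LINT x|?S. (?d t x)\<^sup>2 / 2))"
  proof (intro sum.cong refl)
    fix t assume "t \<in> {..<n}"
    then have t: "t < n" by simp
    show "(LINT x|?S. ?d t x * snd x t - (?d t x)\<^sup>2 / 2) = - (LINT x|?S. (?d t x)\<^sup>2 / 2)"
      using Bochner_Integration.integral_diff[OF i1[OF t] i2[OF t]]
        expectation_fun_chosen_arm_noise[OF st t, of "\<lambda>a. \<nu> a - \<mu> a" \<mu>] by simp
  qed
  also have "\<dots> = - (LINT x|?S. (\<Sum>t<n. (?d t x)\<^sup>2 / 2))"
    by (subst Bochner_Integration.integral_sum) (use i2 in \<open>auto simp: sum_negf\<close>)
  finally show ?thesis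
    using sum_expected_pulls_mult[OF st, of "\<lambda>a. (\<nu> a - \<mu> a)\<^sup>2 / 2" \<mu> n] by simp
qed

text \<open>A linear lower bound for \<open>min 1 (exp l)\<close>: it comes from
  \<open>2 * sqrt (min 1 m * max 1 m) \<le> s * min 1 m + max 1 m / s\<close>, \<open>min 1 m + max 1 m = 1 + m\<close>
  and the tangent of \<open>exp (l / 2)\<close> at \<open>b\<close>.\<close>

lemma min_one_exp_ge:
  fixes s l b :: real
  assumes "s > 0"
  shows "2 * exp (b / 2) * (1 + (l - b) / 2) - (1 + exp l) / s \<le> (s - 1 / s) * min 1 (exp l)"
proof -
  let ?p = "min 1 (exp l)" and ?q = "max 1 (exp l)"
  have pq: "?p * ?q = exp l" "?p + ?q = 1 + exp l" "?p > 0" "?q > 0" by (auto simp: min_def max_def)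
  have "exp (b / 2) * (1 + (l - b) / 2) \<le> exp (b / 2) * exp ((l - b) / 2)"
    by (intro mult_left_mono exp_ge_add_one_self) auto
  also have "\<dots> = exp (l / 2)" by (simp add: exp_add[symmetric] field_simps)
  finally have tangent: "exp (b / 2) * (1 + (l - b) / 2) \<le> exp (l / 2)" .
  have "2 * exp (l / 2) \<le> s * ?p + ?q / s"
  proof (rule power2_le_imp_le)
    have "(2 * exp (l / 2))\<^sup>2 = 4 * ((s * ?p) * (?q / s))"
      using assms pq(1) by (simp add: power_mult_distrib exp_double[symmetric])
    also have "\<dots> \<le> (s * ?p + ?q / s)\<^sup>2"
    proof -
      have "4 * (u * v) \<le> (u + v)\<^sup>2" for u v :: real
        using zero_le_power2[of "u - v"] by (simp add: power2_diff power2_sum)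
      then show ?thesis .
    qed
    finally show "(2 * exp (l / 2))\<^sup>2 \<le> (s * ?p + ?q / s)\<^sup>2" .
  qed (use assms pq in auto)
  also have "\<dots> = s * ?p + (1 + exp l - ?p) / s" using pq(2) by simp
  also have "\<dots> = (s - 1 / s) * ?p + (1 + exp l) / s"
    by (simp add: left_diff_distrib diff_divide_distrib)
  finally show ?thesis using tangent by linarith
qed

text \<open>Carries the change of measure over to Bochner integrals. The weighted count is
  integrable because its nonnegative integral equals that of the bounded, unweighted count under
  \<open>\<nu>\<close>.\<close>

lemma history_change_of_measure_count:
  fixes R :: "'r measure" and \<mu> \<nu> :: "'a::finite \<Rightarrow> real" and f :: "'a \<Rightarrow> real" and n :: nat
  assumes st: "strategy R \<pi>" and f: "\<And>a. 0 \<le> f a"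
  defines "F \<equiv> \<lambda>\<xi> x. (\<Sum>t<n. f (chosen_arm \<pi> \<xi> (fst x) (snd x) t))"
  shows "(LINT x|sample_space R n. F \<nu> x)
    = (LINT x|sample_space R n. exp (log_likelihood_ratio \<pi> \<mu> \<nu> n x) * F \<mu> x)"
    and "integrable (sample_space R n) (\<lambda>x. exp (log_likelihood_ratio \<pi> \<mu> \<nu> n x) * F \<mu> x)"
proof -
  let ?S = "sample_space R n"
  \<comment> \<open>The count read off the recorded arms, which do not mention the
    environment.\<close>
  define H where "H p = (\<Sum>t<n. f (fst (snd p t)))" for p :: "'r \<times> 'a history"
  have "(\<lambda>p. f (fst (snd p t))) \<in> borel_measurable (R \<Otimes>\<^sub>M history_space n)" if "t < n" for t
  proof -
    have "(\<lambda>p. snd p t) \<in> R \<Otimes>\<^sub>M history_space n \<rightarrow>\<^sub>M count_space UNIV \<Otimes>\<^sub>M borel"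
      by (rule measurable_compose[OF measurable_snd measurable_component_singleton]) (use that in simp)
    then have "(\<lambda>p. fst (snd p t)) \<in> R \<Otimes>\<^sub>M history_space n \<rightarrow>\<^sub>M count_space UNIV"
      by (rule measurable_compose[OF _ measurable_fst])
    then show ?thesis by (rule measurable_compose) simp
  qed
  then have H: "(\<lambda>p. ennreal (H p)) \<in> borel_measurable (R \<Otimes>\<^sub>M history_space n)"
    unfolding H_def by (intro measurable_compose[OF _ measurable_ennreal] borel_measurable_sum) auto
  have HF: "H (fst x, history \<pi> \<xi> (fst x) (snd x) n) = F \<xi> x" for \<xi> x
    by (simp add: H_def F_def fst_history)
  have F0: "F \<xi> x \<ge> 0" for \<xi> x by (simp add: F_def sum_nonneg f)
  have Fi: "integrable ?S (F \<xi>)" for \<xi>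
    unfolding F_def by (intro Bochner_Integration.integrable_sum integrable_fun_chosen_arm st) auto
  have [measurable]: "F \<xi> \<in> borel_measurable ?S" for \<xi> using Fi by auto
  note [measurable] = measurable_log_likelihood_ratio[OF st]
  have eq: "(\<integral>\<^sup>+x. ennreal (F \<nu> x) \<partial>?S) =
      (\<integral>\<^sup>+x. ennreal (exp (log_likelihood_ratio \<pi> \<mu> \<nu> n x) * F \<mu> x) \<partial>?S)"
    using history_change_of_measure[OF st H, of \<nu> \<mu>] by (simp add: HF ennreal_mult F0)
  show "(LINT x|?S. F \<nu> x) = (LINT x|?S. exp (log_likelihood_ratio \<pi> \<mu> \<nu> n x) * F \<mu> x)"
    by (simp add: integral_eq_nn_integral F0 eq)
  show "integrable ?S (\<lambda>x. exp (log_likelihood_ratio \<pi> \<mu> \<nu> n x) * F \<mu> x)"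
  proof (rule integrableI_nonneg)
    show "(\<integral>\<^sup>+x. ennreal (exp (log_likelihood_ratio \<pi> \<mu> \<nu> n x) * F \<mu> x) \<partial>?S) < \<infinity>"
      using Fi[of \<nu>] F0 by (simp add: eq[symmetric] integrable_iff_bounded)
  qed (auto simp: F0)
qed

text \<open>The weight \<open>1 / real n\<close> in every round makes the count identically 1. For
  \<open>n = 0\<close> that count would be an empty sum, so this case is treated apart.\<close>

lemma exp_log_likelihood_ratio:
  fixes \<mu> \<nu> :: "'a::finite \<Rightarrow> real"
  assumes st: "strategy R \<pi>"
  shows "integrable (sample_space R n) (\<lambda>x. exp (log_likelihood_ratio \<pi> \<mu> \<nu> n x))"
    and "(LINT x|sample_space R n. exp (log_likelihood_ratio \<pi> \<mu> \<nu> n x)) = 1"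
proof -
  interpret prob_space "sample_space R n"
    using assms by (intro prob_space_sample_space) (simp add: strategy_def)
  have "integrable (sample_space R n) (\<lambda>x. exp (log_likelihood_ratio \<pi> \<mu> \<nu> n x)) \<and>
    (LINT x|sample_space R n. exp (log_likelihood_ratio \<pi> \<mu> \<nu> n x)) = 1"
  proof (cases n)
    case 0
    moreover have "integrable (sample_space R n) (\<lambda>_. 1::real)" by simp
    ultimately show ?thesis using prob_space by (simp add: log_likelihood_ratio_def)
  next
    case (Suc m)
    then show ?thesis
      using history_change_of_measure_count[OF st, where f = "\<lambda>_. 1 / real n" and n = n and \<mu> = \<mu> and \<nu> = \<nu>]
        prob_space by simp
  qed
  then show "integrable (sample_space R n) (\<lambda>x. exp (log_likelihood_ratio \<pi> \<mu> \<nu> n x))"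
    and "(LINT x|sample_space R n. exp (log_likelihood_ratio \<pi> \<mu> \<nu> n x)) = 1"
    by auto
qed

text \<open>The Bretagnolle--Huber inequality, applied to the \<open>[0, 1]\<close>-valued statistic
  (number of pulls of \<open>i\<close>) \<open>/ n\<close> instead of an event.\<close>

lemma expected_pulls_two_environments:
  fixes \<mu> :: "'a::finite \<Rightarrow> real"
  assumes st: "strategy R \<pi>"
  shows "expected_pulls R \<pi> \<mu> n i + (real n - expected_pulls R \<pi> (\<mu>(i := \<mu> i + d)) n i)
    \<ge> real n / 2 * exp (- d\<^sup>2 / 2 * expected_pulls R \<pi> \<mu> n i)"
proof -
  let ?S = "sample_space R n"
  define \<nu> where "\<nu> = \<mu>(i := \<mu> i + d)"
  define T where "T = expected_pulls R \<pi> \<mu> n i"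
  define L where "L = log_likelihood_ratio \<pi> \<mu> \<nu> n"
  define A where "A \<xi> x = (\<Sum>t<n. of_bool (chosen_arm \<pi> \<xi> (fst x) (snd x) t = i) :: real)" for \<xi> x
  define B where "B \<xi> x = (\<Sum>t<n. of_bool (chosen_arm \<pi> \<xi> (fst x) (snd x) t \<noteq> i) :: real)" for \<xi> x
  \<comment> \<open>The mean of \<open>L\<close>, by \<open>EL\<close> below. The tangent is taken
    there so that its linear term integrates to 0.\<close>
  define b where "b = - d\<^sup>2 / 2 * T"
  \<comment> \<open>With this choice
    \<open>2 * exp (b / 2) - 2 / s = exp (b / 2) = s * exp b / 2\<close>, which is at least
    \<open>(s - 1 / s) * exp b / 2\<close>.\<close>
  define s where "s = 2 / exp (b / 2)"
  interpret prob_space ?S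
    using assms by (intro prob_space_sample_space) (simp add: strategy_def)
  have T: "T = (LINT x|?S. A \<mu> x)" "T \<ge> 0"
    by (auto simp: T_def A_def expected_pulls_def intro: expected_pulls_nonneg[unfolded expected_pulls_def])
  have Ai: "integrable ?S (A \<xi>)" for \<xi>
    unfolding A_def
    by (intro Bochner_Integration.integrable_sum integrable_fun_chosen_arm[where f = "\<lambda>a. of_bool (a = i)"] st) auto
  have AB: "B \<xi> x = real n - A \<xi> x" for \<xi> x
    unfolding A_def B_def of_bool_not_iff by (simp add: sum_subtractf)
  have nonneg: "A \<xi> x \<ge> 0" "B \<xi> x \<ge> 0" for \<xi> x
    by (auto simp: A_def B_def intro!: sum_nonneg)
  have "(LINT x|?S. L x) = - (\<Sum>j\<in>UNIV. (\<nu> j - \<mu> j)\<^sup>2 / 2 * expected_pulls R \<pi> \<mu> n j)"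
    unfolding L_def by (rule expectation_log_likelihood_ratio[OF st])
  also have "(\<Sum>j\<in>UNIV. (\<nu> j - \<mu> j)\<^sup>2 / 2 * expected_pulls R \<pi> \<mu> n j)
      = (\<Sum>j\<in>UNIV. if j = i then d\<^sup>2 / 2 * T else 0)"
    by (intro sum.cong) (auto simp: \<nu>_def T_def)
  finally have EL: "(LINT x|?S. L x) = b" by (simp add: b_def)
  have Li: "integrable ?S L" unfolding L_def by (rule integrable_log_likelihood_ratio[OF st])
  have expL: "integrable ?S (\<lambda>x. exp (L x))" "(LINT x|?S. exp (L x)) = 1"
    unfolding L_def by (rule exp_log_likelihood_ratio[OF st])+
  have cm: "(LINT x|?S. B \<nu> x) = (LINT x|?S. exp (L x) * B \<mu> x)"
      "integrable ?S (\<lambda>x. exp (L x) * B \<mu> x)"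
    using history_change_of_measure_count[OF st, where f = "\<lambda>a. of_bool (a \<noteq> i)" and n = n and \<mu> = \<mu> and \<nu> = \<nu>]
    unfolding B_def L_def by auto
  have "real n - expected_pulls R \<pi> \<nu> n i = (LINT x|?S. B \<nu> x)"
    using Ai[of \<nu>] by (simp add: AB prob_space expected_pulls_def A_def[symmetric])
  \<comment> \<open>Both counts become integrals over the \<open>\<mu>\<close> run, the second one
    weighted by the likelihood ratio.\<close>
  then have lhs: "T + (real n - expected_pulls R \<pi> \<nu> n i) = (LINT x|?S. A \<mu> x + exp (L x) * B \<mu> x)"
    using Ai cm T by simp
  \<comment> \<open>Nonpositivity of \<open>b\<close> gives \<open>s \<ge> 2\<close>, so the factor
    \<open>s - 1 / s\<close> is positive and can be cancelled at the end.\<close>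
  have b0: "b \<le> 0" using T(2) by (simp add: b_def)
  have eb: "exp (b / 2) \<le> 1" using b0 by simp
  have s: "s \<ge> 2" unfolding s_def using eb by (simp add: field_simps)
  have pos: "s - 1 / s > 0"
  proof -
    have "1 / s \<le> 1 / 2" using s by (simp add: field_simps)
    then show ?thesis using s by linarith
  qed
  \<comment> \<open>As \<open>A \<mu> x\<close> and \<open>B \<mu> x\<close> add up to
    \<open>n\<close>, replacing both weights 1 and \<open>exp (L x)\<close> by their minimum leaves
    \<open>n\<close> times that minimum, which the linear lower bound then controls.\<close>
  have ptw: "real n * (2 * exp (b / 2) * (1 + (L x - b) / 2) - (1 + exp (L x)) / s)
      \<le> (s - 1 / s) * (A \<mu> x + exp (L x) * B \<mu> x)" for x
  proof -
    have "real n * min 1 (exp (L x)) = A \<mu> x * min 1 (exp (L x)) + B \<mu> x * min 1 (exp (L x))"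
      by (simp add: AB distrib_right[symmetric])
    also have "\<dots> \<le> A \<mu> x * 1 + B \<mu> x * exp (L x)"
      by (intro add_mono mult_left_mono nonneg) auto
    finally have *: "real n * min 1 (exp (L x)) \<le> A \<mu> x + exp (L x) * B \<mu> x"
      by (simp add: mult.commute)
    have "real n * (2 * exp (b / 2) * (1 + (L x - b) / 2) - (1 + exp (L x)) / s)
        \<le> real n * ((s - 1 / s) * min 1 (exp (L x)))"
      using s by (intro mult_left_mono min_one_exp_ge) auto
    also have "\<dots> = (s - 1 / s) * (real n * min 1 (exp (L x)))" by simp
    also have "\<dots> \<le> (s - 1 / s) * (A \<mu> x + exp (L x) * B \<mu> x)"
      using * pos by (intro mult_left_mono) auto
    finally show ?thesis .
  qed
  have "real n * (2 * exp (b / 2) - 2 / s)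
      = (LINT x|?S. real n * (2 * exp (b / 2) * (1 + (L x - b) / 2) - (1 + exp (L x)) / s))"
    using Li expL EL by (simp add: prob_space)
  also have "\<dots> \<le> (LINT x|?S. (s - 1 / s) * (A \<mu> x + exp (L x) * B \<mu> x))"
    by (intro integral_mono ptw) (use Li expL cm Ai in auto)
  also have "\<dots> = (s - 1 / s) * (T + (real n - expected_pulls R \<pi> \<nu> n i))"
    unfolding lhs by simp
  finally have main: "real n * (2 * exp (b / 2) - 2 / s)
      \<le> (s - 1 / s) * (T + (real n - expected_pulls R \<pi> \<nu> n i))" .
  have "(s - 1 / s) * (real n / 2 * exp b) \<le> s * (real n / 2 * exp b)"
    using s by (intro mult_right_mono) auto
  also have "\<dots> = real n * (2 * exp (b / 2) - 2 / s)"
  proof -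
    have "exp b = exp (b / 2) * exp (b / 2)" by (simp add: exp_add[symmetric])
    then show ?thesis by (simp add: s_def field_simps)
  qed
  finally have "(s - 1 / s) * (real n / 2 * exp b)
      \<le> (s - 1 / s) * (T + (real n - expected_pulls R \<pi> \<nu> n i))"
    using main by linarith
  then have "real n / 2 * exp b \<le> T + (real n - expected_pulls R \<pi> \<nu> n i)"
    using pos by (simp only: mult_le_cancel_left_pos)
  then show ?thesis by (simp add: T_def \<nu>_def b_def)
qed

section \<open>Gaps and the quantities \<open>k_half\<close>\<close>

lemma gap_nonneg: "gap \<mu> i \<ge> 0" for \<mu> :: "'a::finite \<Rightarrow> real"
  by (simp add: gap_def)

lemma gap_le_1: "(\<And>i. \<mu> i \<in> {0..1}) \<Longrightarrow> gap \<mu> i \<le> 1" for \<mu> :: "'a::finite \<Rightarrow> real"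
  by (subst gap_def, subst diff_le_eq, subst Max_le_iff) (auto intro: add_increasing2)

lemma ex_gap_eq_0: "\<exists>i. gap \<mu> i = 0" for \<mu> :: "'a::finite \<Rightarrow> real"
proof -
  have "Max (range \<mu>) \<in> range \<mu>" by (rule Max_in) auto
  then obtain i where "Max (range \<mu>) = \<mu> i" by blast
  then show ?thesis by (auto simp: gap_def)
qed

lemma k_half_summand_nonneg:
  "0 \<le> (if gap \<mu> j = 0 then 1 else min 1 (gap \<mu> i / gap \<mu> j))" for \<mu> :: "'a::finite \<Rightarrow> real"
  by (simp add: gap_nonneg)

text \<open>Splitting off the summand 1 of arm \<open>i\<close> itself: the sum over the other arms
  is the weight \<open>k_half \<mu> i - 1\<close> of the final estimate.\<close>

lemma k_half_eq_if:
  fixes \<mu> :: "'a::finite \<Rightarrow> real"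
  assumes "gap \<mu> i > 0"
  shows "k_half \<mu> i = 1 + (\<Sum>j\<in>-{i}. if gap \<mu> j = 0 then 1 else min 1 (gap \<mu> i / gap \<mu> j))"
  using assms unfolding k_half_def Compl_eq_Diff_UNIV by (subst sum.remove[of UNIV i]) auto

text \<open>Arm \<open>i\<close> and some optimal arm contribute 1 each.\<close>

lemma k_half_ge_2:
  fixes \<mu> :: "'a::finite \<Rightarrow> real"
  assumes "gap \<mu> i > 0"
  shows "k_half \<mu> i \<ge> 2"
proof -
  obtain o' where o': "gap \<mu> o' = 0" using ex_gap_eq_0 by blast
  have "(if gap \<mu> o' = 0 then 1 else min 1 (gap \<mu> i / gap \<mu> o'))
      \<le> (\<Sum>j\<in>-{i}. if gap \<mu> j = 0 then 1 else min 1 (gap \<mu> i / gap \<mu> j))"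
    by (rule member_le_sum[of o']) (use o' assms k_half_summand_nonneg in \<open>fastforce+\<close>)
  then show ?thesis using o' by (simp add: k_half_eq_if[OF assms])
qed

text \<open>At a largest gap no summand is below 1. This is how the hypothesis on that gap bounds
  the number of arms.\<close>

lemma k_half_eq_card:
  fixes \<mu> :: "'a::finite \<Rightarrow> real"
  assumes "\<And>j. gap \<mu> j \<le> gap \<mu> i"
  shows "k_half \<mu> i = CARD('a)"
proof -
  have "(if gap \<mu> j = 0 then 1 else min 1 (gap \<mu> i / gap \<mu> j)) = 1" for j
  proof (cases "gap \<mu> j = 0")
    case False
    then have "1 \<le> gap \<mu> i / gap \<mu> j"
      using gap_nonneg[of \<mu> j] assms[of j] by (simp add: le_divide_eq)
    with False show ?thesis by simp
  qed simp
  then show ?thesis by (simp add: k_half_def)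
qed

lemma k_half_eq_2:
  fixes \<mu> :: "'a::finite \<Rightarrow> real"
  assumes "gap \<mu> i > 0" "CARD('a) \<le> 2"
  shows "k_half \<mu> i = 2"
proof -
  have "k_half \<mu> i \<le> (\<Sum>j\<in>(UNIV::'a set). 1)"
    unfolding k_half_def by (intro sum_mono) auto
  then show ?thesis using k_half_ge_2[OF assms(1)] assms(2) by simp
qed

text \<open>Arm \<open>i\<close> moves from \<open>gap \<mu> i\<close> below the old maximum to
  \<open>gap \<mu> i\<close> above it, so every other arm falls behind by that much more.\<close>

lemma gap_fun_upd:
  fixes \<mu> :: "'a::finite \<Rightarrow> real"
  assumes "gap \<mu> i > 0"
  defines "\<mu>' \<equiv> \<mu>(i := \<mu> i + 2 * gap \<mu> i)"
  shows "gap \<mu>' i = 0" and "j \<noteq> i \<Longrightarrow> gap \<mu>' j = gap \<mu> i + gap \<mu> j"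
proof -
  have le: "\<mu> j \<le> Max (range \<mu>)" for j by simp
  have "Max (range \<mu>') = \<mu>' i"
  proof (rule Max_eqI)
    fix y assume "y \<in> range \<mu>'"
    then obtain j where "y = \<mu>' j" by blast
    then show "y \<le> \<mu>' i"
      using le[of j] le[of i] by (cases "j = i") (simp_all add: \<mu>'_def gap_def del: Max_ge)
  qed auto
  then show "gap \<mu>' i = 0" and "j \<noteq> i \<Longrightarrow> gap \<mu>' j = gap \<mu> i + gap \<mu> j"
    by (auto simp: gap_def \<mu>'_def)
qed

section \<open>Numerical estimates for logarithms\<close>

lemma ln_2_gt: "ln 2 > (2 / 3 :: real)"
proof -
  have "exp (2::real) = exp 1 * exp 1" by (simp add: exp_add[symmetric])
  also have "\<dots> < 272 / 100 * (272 / 100)"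
    using e_less_272 by (intro mult_strict_mono) auto
  finally have "exp 2 < (8::real)" by simp
  then have "2 < ln (8::real)" using ln_less_cancel_iff[of "exp 2" "8::real"] by simp
  then show ?thesis using ln_realpow[of 2 3] by simp
qed

lemma ln_ge_3_halves:
  fixes n :: nat
  assumes "n \<ge> 5"
  shows "ln (real n) \<ge> 3 / 2"
proof -
  have "exp (3::real) = exp 1 * exp 1 * exp 1" by (simp add: exp_add[symmetric])
  also have "\<dots> \<le> 272 / 100 * (272 / 100) * (272 / 100)"
    using e_less_272 by (intro mult_mono) auto
  finally have "exp 3 \<le> (5^2::real)" by simp
  then have "3 \<le> ln (5^2::real)" by (subst ln_ge_iff) auto
  then have "3 / 2 \<le> ln (5::real)" using ln_realpow[of 5 2] by simp
  also have "\<dots> \<le> ln (real n)" using assms by simp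
  finally show ?thesis .
qed

text \<open>A rational version of \<open>ln y \<le> y / exp 1\<close>, using
  \<open>5 / 2 \<le> exp 1\<close>.\<close>

lemma ln_le_two_fifths: "y > 0 \<Longrightarrow> ln y \<le> 2 / 5 * y" for y :: real
proof -
  assume y: "y > 0"
  have "exp (1::real) \<ge> 5 / 2" using exp_lower_Taylor_quadratic[of 1] by simp
  then have "ln (5 / 2) \<le> (1::real)" using ln_le_cancel_iff[of "5 / 2" "exp 1 :: real"] by simp
  moreover have "ln (2 / 5 * y) \<le> 2 / 5 * y - 1"
    using y by (intro ln_le_minus_one) auto
  moreover have "ln (2 / 5 * y) = ln y - ln (5 / 2)"
    using y by (simp add: ln_mult ln_div)
  ultimately show ?thesis by simp
qed

text \<open>Three or more arms will force \<open>3 * ln n \<le> n\<close>; the values 2, 3 and 4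
  violate this.\<close>

lemma five_le_of_three_ln_le:
  fixes n :: nat
  assumes "n \<ge> 2" "3 * ln (real n) \<le> real n"
  shows "n \<ge> 5"
proof (rule ccontr)
  assume "\<not> n \<ge> 5"
  then consider "n = 2" | "n = 3" | "n = 4" using assms(1) by linarith
  then show False
  proof cases
    case 2
    have "1 < ln (3::real)" using e_less_272 ln_less_cancel_iff[of "exp 1" "3::real"] by simp
    with 2 show ?thesis using assms(2) by simp
  next
    case 3
    then show ?thesis using assms(2) ln_2_gt ln_realpow[of 2 2] by simp
  qed (use assms(2) ln_2_gt in simp)
qed

text \<open>In terms of \<open>sqrt x\<close>, the claim is
  \<open>6 * ln (sqrt x) \<le> 4 * ln n * sqrt x\<close>; the left side is at most
  \<open>12 / 5 * sqrt x\<close> and the right side at least \<open>8 / 3 * sqrt x\<close>.\<close>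

lemma two_arm_bound:
  fixes n :: nat and x :: real
  assumes "n \<ge> 2" "x \<ge> 1"
  shows "2 * ln x \<le> 4 * ln (real n) * sqrt x - ln x"
proof -
  have "ln 2 \<le> ln (real n)" using assms(1) by simp
  then have "4 * (2 / 3) * sqrt x \<le> 4 * ln (real n) * sqrt x"
    using ln_2_gt assms(2) by (intro mult_right_mono) auto
  moreover have "ln x = 2 * ln (sqrt x)" using assms(2) by (simp add: ln_sqrt)
  moreover have "ln (sqrt x) \<le> 2 / 5 * sqrt x" using assms(2) by (intro ln_le_two_fifths) auto
  moreover have "sqrt x \<ge> 0" using assms(2) by simp
  ultimately show ?thesis by linarith
qed

text \<open>The left side is at most \<open>2 * k * ln n\<close>, the right side at
  \<open>x = 1\<close>. The growth of \<open>sqrt x\<close> then pays for \<open>ln x\<close>, since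
  \<open>ln x \<le> 2 * (sqrt x - 1)\<close> and \<open>k * ln n \<ge> 1\<close>.\<close>

lemma many_arm_bound:
  fixes n :: nat and x k :: real
  assumes n: "n \<ge> 5" and x: "x \<ge> 1" and k: "k \<ge> 1" "k * ln (real n) \<le> real n"
  shows "2 * (k - 1) * ln (2 * real n / ln (real n)) \<le> 2 * k * ln (real n) * sqrt x - ln x"
proof -
  define L where "L = ln (real n)"
  have L: "L \<ge> 3 / 2" unfolding L_def by (rule ln_ge_3_halves[OF n])
  have "ln (2 * real n / L) = L + ln (2 / L)"
    using L n by (simp add: ln_div ln_mult L_def)
  moreover have "(k - 1) * ln (2 / L) \<le> L"
  proof (cases "L \<ge> 2")
    case True
    then have "ln (2 / L) \<le> 0" using L by (subst ln_le_zero_iff) auto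
    then have "(k - 1) * ln (2 / L) \<le> 0" using k by (intro mult_nonneg_nonpos) auto
    then show ?thesis using L by linarith
  next
    case False
    \<comment> \<open>\<open>L < 2\<close> leaves only \<open>n\<close> from 5 to 7. Then
      \<open>k \<le> 14 / 3\<close> and \<open>ln (2 / L) \<le> 1 / 3\<close>, so the product is at
      most \<open>11 / 9 < 3 / 2 \<le> L\<close>.\<close>
    have "n \<le> 7"
    proof (rule ccontr)
      assume "\<not> n \<le> 7"
      then have "ln 8 \<le> L" unfolding L_def by simp
      moreover have "ln (8::real) = 3 * ln 2" using ln_realpow[of 2 3] by simp
      ultimately show False using ln_2_gt False by linarith
    qed
    moreover have "k * (3 / 2) \<le> k * L" using L k by (intro mult_left_mono) auto
    ultimately have k1: "k - 1 \<le> 11 / 3" using k(2) by (simp add: L_def)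
    have "ln (2 / L) \<le> 2 / L - 1" using L by (intro ln_le_minus_one) auto
    moreover have "2 / L \<le> 2 / (3 / 2)" using L by (intro divide_left_mono) auto
    ultimately have "ln (2 / L) \<le> 1 / 3" by simp
    moreover have "0 \<le> ln (2 / L)" using False L by (intro ln_ge_zero) auto
    ultimately have "(k - 1) * ln (2 / L) \<le> 11 / 3 * (1 / 3)"
      using k k1 by (intro mult_mono) auto
    then show ?thesis using L by linarith
  qed
  ultimately have lhs: "(k - 1) * ln (2 * real n / L) \<le> k * L"
    by (simp add: algebra_simps)
  have "ln x = 2 * ln (sqrt x)" using x by (simp add: ln_sqrt)
  moreover have "ln (sqrt x) \<le> sqrt x - 1" using x by (intro ln_le_minus_one) auto
  moreover have "1 * (sqrt x - 1) \<le> (k * L) * (sqrt x - 1)"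
  proof (rule mult_right_mono)
    have "1 * 1 \<le> k * L" using k L by (intro mult_mono) auto
    then show "1 \<le> k * L" by simp
  qed (use x in simp)
  ultimately have "ln x \<le> 2 * (k * L * sqrt x - k * L)" by (simp add: algebra_simps)
  with lhs have "2 * ((k - 1) * ln (2 * real n / L)) \<le> 2 * (k * L * sqrt x) - ln x" by simp
  then show ?thesis by (simp only: L_def mult.assoc)
qed

section \<open>The sum in the second alternative\<close>

text \<open>The right side is \<open>4 * gap \<mu> i\<close> times the regret that the entropy
  argument guarantees in the modified environment, so this inequality is exactly the second
  alternative.\<close>

lemma sum_modified_gaps_le:
  fixes \<mu> :: "'a::finite \<Rightarrow> real" and n :: nat and i :: 'a
  defines "\<mu>' \<equiv> \<mu>(i := \<mu> i + 2 * gap \<mu> i)"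
    and "x \<equiv> real n * (gap \<mu> i)\<^sup>2 / (k_half \<mu> i * ln (real n))"
  assumes n: "n \<ge> 2" and \<mu>: "\<And>i. \<mu> i \<in> {0..1}" and i: "gap \<mu> i > 0"
    and big: "\<And>i. gap \<mu> i > 0 \<Longrightarrow> real n * (gap \<mu> i)\<^sup>2 / (k_half \<mu> i * ln (real n)) \<ge> 1"
  shows "2 * gap \<mu> i *
      (\<Sum>j | gap \<mu>' j > 0. 1 / gap \<mu>' j * ln (real n * (gap \<mu>' j)\<^sup>2 / (k_half \<mu>' j * ln (real n))))
    \<le> 2 * k_half \<mu> i * ln (real n) * sqrt x - ln x"
proof -
  define L where "L = ln (real n)"
  define t where "t j = 1 / gap \<mu>' j * ln (real n * (gap \<mu>' j)\<^sup>2 / (k_half \<mu>' j * L))" for j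
  let ?a = "gap \<mu> i" and ?k = "k_half \<mu> i"
  have L: "L > 0" "L \<le> real n" using n ln_le_minus_one[of "real n"] by (auto simp: L_def)
  have gap': "gap \<mu>' i = 0" "\<And>j. j \<noteq> i \<Longrightarrow> gap \<mu>' j = ?a + gap \<mu> j"
    using gap_fun_upd[OF i] by (auto simp: \<mu>'_def)
  have gap'_pos: "gap \<mu>' j > 0" if "j \<noteq> i" for j
    using that gap' i gap_nonneg[of \<mu> j] by simp
  have set: "{j. gap \<mu>' j > 0} = -{i}"
    using gap' gap'_pos by auto
  have x1: "x \<ge> 1" unfolding x_def by (rule big[OF i])
  \<comment> \<open>Gaps are at most 1, so the hypothesis on an arm bounds its \<open>k_half\<close>
    by \<open>n / ln n\<close>.\<close>
  have kn: "k_half \<mu> j * L \<le> real n" if j: "gap \<mu> j > 0" for j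
  proof -
    have "k_half \<mu> j * L > 0" using k_half_ge_2[OF j] L by simp
    then have "k_half \<mu> j * L \<le> real n * (gap \<mu> j)\<^sup>2"
      using big[OF j] by (simp add: L_def le_divide_eq)
    also have "\<dots> \<le> real n * 1"
      using gap_le_1[of \<mu> j] \<mu> j by (intro mult_left_mono power_le_one) auto
    finally show ?thesis by simp
  qed
  have "2 * ?a * (\<Sum>j\<in>-{i}. t j) \<le> 2 * ?k * L * sqrt x - ln x"
  proof (cases "CARD('a) \<le> 2")
    case True
    obtain j where j: "gap \<mu> j = 0" using ex_gap_eq_0 by blast
    have ji: "j \<noteq> i" using i j by auto
    have "card (-{i}) \<le> 1" using True by (simp add: Compl_eq_Diff_UNIV card_Diff_subset)
    then have "-{i} = {j}" using ji by (auto simp: card_le_Suc0_iff_eq)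
    \<comment> \<open>The only summand is the formerly optimal arm. Its new gap is \<open>?a\<close>
      and \<open>k_half\<close> is 2 in both environments, so its logarithm is exactly
      \<open>ln x\<close>.\<close>
    then have "2 * ?a * (\<Sum>j\<in>-{i}. t j) = 2 * ln x"
      using i j ji gap' gap'_pos[OF ji] True
      by (simp add: t_def x_def L_def k_half_eq_2)
    also have "\<dots> \<le> 4 * L * sqrt x - ln x"
      unfolding L_def by (rule two_arm_bound[OF n x1])
    finally show ?thesis using k_half_eq_2[OF i True] by simp
  next
    case False
    \<comment> \<open>At a largest gap \<open>k_half\<close> counts all arms, of which there are at
      least three; hence \<open>3 * L \<le> n\<close> and \<open>n \<ge> 5\<close>.\<close>
    have "Max (range (gap \<mu>)) \<in> range (gap \<mu>)" by (rule Max_in) auto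
    then obtain m where "gap \<mu> m = Max (range (gap \<mu>))" by (metis rangeE)
    then have m: "gap \<mu> j \<le> gap \<mu> m" for j by simp
    then have "gap \<mu> m > 0" using i by (meson less_le_trans)
    from kn[OF this] have "real CARD('a) * L \<le> real n" by (simp add: k_half_eq_card[OF m])
    moreover have "3 * L \<le> real CARD('a) * L" using False L by (intro mult_right_mono) auto
    ultimately have "3 * L \<le> real n" by linarith
    then have n5: "n \<ge> 5" using n by (intro five_le_of_three_ln_le) (auto simp: L_def)
    \<comment> \<open>Modified gaps are at most 2 and their \<open>k_half\<close> at least 2, which
      gives this common bound for the logarithms.\<close>
    let ?B = "ln (2 * real n / L)"
    have B: "?B \<ge> 0" using L by (intro ln_ge_zero) (simp add: le_divide_eq)
    have "?a * t j \<le> (if gap \<mu> j = 0 then 1 else min 1 (?a / gap \<mu> j)) * ?B" if j: "j \<in> -{i}" for j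
    proof -
      have g: "gap \<mu>' j > 0" "gap \<mu>' j \<le> 2" "gap \<mu>' j = ?a + gap \<mu> j" "gap \<mu> j \<ge> 0"
        using gap'_pos[of j] gap'(2)[of j] gap_le_1[of \<mu> i] gap_le_1[of \<mu> j] \<mu> j gap_nonneg[of \<mu> j]
        by auto
      have k2: "k_half \<mu>' j \<ge> 2" by (rule k_half_ge_2[OF g(1)])
      have "real n * (gap \<mu>' j)\<^sup>2 / (k_half \<mu>' j * L) \<le> real n * 2\<^sup>2 / (2 * L)"
        using g k2 L by (intro frac_le mult_left_mono mult_right_mono power_mono) auto
      also have "\<dots> = 2 * real n / L" by simp
      finally have "ln (real n * (gap \<mu>' j)\<^sup>2 / (k_half \<mu>' j * L)) \<le> ?B"
        using g k2 L n by (intro ln_mono) auto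
      then have "?a * t j \<le> ?a / gap \<mu>' j * ?B"
        unfolding t_def using i g by (simp add: mult_left_mono divide_right_mono)
      \<comment> \<open>The weight \<open>?a / (?a + gap \<mu> j)\<close> is dominated by the
        summand of arm \<open>j\<close> in \<open>k_half \<mu> i\<close>.\<close>
      also have "?a / gap \<mu>' j \<le> (if gap \<mu> j = 0 then 1 else min 1 (?a / gap \<mu> j))"
      proof -
        have "?a / gap \<mu>' j \<le> 1" using g i by simp
        moreover have "?a / gap \<mu>' j \<le> ?a / gap \<mu> j" if "gap \<mu> j \<noteq> 0"
          using that g i by (intro divide_left_mono) auto
        ultimately show ?thesis by simp
      qed
      then have "?a / gap \<mu>' j * ?B \<le> (if gap \<mu> j = 0 then 1 else min 1 (?a / gap \<mu> j)) * ?B"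
        using B by (rule mult_right_mono)
      finally show ?thesis .
    qed
    then have "?a * (\<Sum>j\<in>-{i}. t j) \<le> (?k - 1) * ?B"
      unfolding k_half_eq_if[OF i] add_diff_cancel_left' sum_distrib_left sum_distrib_right by (rule sum_mono)
    moreover have "2 * (?k - 1) * ?B \<le> 2 * ?k * L * sqrt x - ln x"
      unfolding L_def using k_half_ge_2[OF i] kn[OF i]
      by (intro many_arm_bound n5 x1) (auto simp: L_def)
    ultimately show ?thesis by linarith
  qed
  then show ?thesis unfolding set t_def L_def .
qed

section \<open>Choice of the arm and conclusion\<close>

theorem theorem11:
  fixes R :: "'r measure"
    and \<pi> :: "nat \<Rightarrow> 'r \<Rightarrow> 'a::finite history \<Rightarrow> 'a"
    and \<mu> :: "'a \<Rightarrow> real"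
    and n :: nat
  assumes "n \<ge> 2"
    and "strategy R \<pi>"
    and "\<And>i. \<mu> i \<in> {0..1}"
    and "\<And>i. gap \<mu> i > 0 \<Longrightarrow> real n * (gap \<mu> i)\<^sup>2 / (k_half \<mu> i * ln (real n)) \<ge> 1"
  shows "pseudo_regret R \<pi> \<mu> n \<ge>
           1 / 4 * (\<Sum>i | gap \<mu> i > 0.
             1 / gap \<mu> i * ln (real n * (gap \<mu> i)\<^sup>2 / (k_half \<mu> i * ln (real n))))
       \<or> (\<exists>i. gap \<mu> i > 0 \<and>
           (let \<mu>' = \<mu>(i := \<mu> i + 2 * gap \<mu> i) in
             pseudo_regret R \<pi> \<mu>' n \<ge>
               1 / 2 * (\<Sum>j | gap \<mu>' j > 0.
                 1 / gap \<mu>' j * ln (real n * (gap \<mu>' j)\<^sup>2 / (k_half \<mu>' j * ln (real n))))))"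
proof (subst disj_commute, rule disjCI)
  let ?x = "\<lambda>i. real n * (gap \<mu> i)\<^sup>2 / (k_half \<mu> i * ln (real n))"
  assume "\<not> 1 / 4 * (\<Sum>i | gap \<mu> i > 0. 1 / gap \<mu> i * ln (?x i)) \<le> pseudo_regret R \<pi> \<mu> n"
  then have "pseudo_regret R \<pi> \<mu> n < (\<Sum>i | gap \<mu> i > 0. 1 / 4 * (1 / gap \<mu> i * ln (?x i)))"
    by (simp only: sum_distrib_left not_le)
  moreover have "pseudo_regret R \<pi> \<mu> n = (\<Sum>i | gap \<mu> i > 0. gap \<mu> i * expected_pulls R \<pi> \<mu> n i)"
    unfolding pseudo_regret_eq_sum[OF assms(2)]
    using gap_nonneg[of \<mu>] by (intro sum.mono_neutral_right) (auto simp: order.order_iff_strict)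
  ultimately have "\<not> (\<Sum>i | gap \<mu> i > 0. 1 / 4 * (1 / gap \<mu> i * ln (?x i)))
      \<le> (\<Sum>i | gap \<mu> i > 0. gap \<mu> i * expected_pulls R \<pi> \<mu> n i)"
    by simp
  \<comment> \<open>If no suboptimal arm were pulled this rarely, summing over the arms would give
    the first alternative.\<close>
  then obtain i where i: "gap \<mu> i > 0"
    and pulls: "gap \<mu> i * expected_pulls R \<pi> \<mu> n i < 1 / 4 * (1 / gap \<mu> i * ln (?x i))"
    using sum_mono[of "{i. gap \<mu> i > 0}" "\<lambda>i. 1 / 4 * (1 / gap \<mu> i * ln (?x i))"
        "\<lambda>i. gap \<mu> i * expected_pulls R \<pi> \<mu> n i"]
    by (metis (no_types, lifting) mem_Collect_eq not_le)
  define \<mu>' where "\<mu>' = \<mu>(i := \<mu> i + 2 * gap \<mu> i)"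
  define a where "a = gap \<mu> i"
  define L where "L = ln (real n)"
  define k where "k = k_half \<mu> i"
  define x where "x = ?x i"
  define T where "T = expected_pulls R \<pi> \<mu> n i"
  have a: "a > 0" using i by (simp add: a_def)
  have L: "L > 0" using assms(1) by (simp add: L_def)
  have k: "k > 0" using k_half_ge_2[OF i] by (simp add: k_def)
  have x: "x \<ge> 1" unfolding x_def by (rule assms(4)[OF i])
  have nx: "real n = x * k * L / a\<^sup>2"
    using a L k by (simp add: x_def a_def L_def k_def)
  \<comment> \<open>The left side is the relative entropy \<open>(2 * a)\<^sup>2 / 2 * T\<close>
    caused by raising arm \<open>i\<close> by \<open>2 * a\<close>; its exponential loss is
    therefore at worst \<open>1 / sqrt x\<close>.\<close>
  have T: "2 * a\<^sup>2 * T \<le> ln x / 2"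
    using pulls a by (simp add: T_def x_def a_def[symmetric] field_simps power2_eq_square)
  have gap': "gap \<mu>' i = 0" "\<And>j. j \<noteq> i \<Longrightarrow> gap \<mu>' j = a + gap \<mu> j"
    using gap_fun_upd[OF i] by (auto simp: \<mu>'_def a_def)
  have "1 / sqrt x = exp (- (ln x / 2))"
    using x by (simp add: exp_minus ln_sqrt[symmetric] inverse_eq_divide)
  also have "\<dots> \<le> exp (- (2 * a)\<^sup>2 / 2 * T)" using T by simp
  finally have "real n / 2 * (1 / sqrt x) \<le> real n / 2 * exp (- (2 * a)\<^sup>2 / 2 * T)"
    by (intro mult_left_mono) auto
  also have "\<dots> \<le> T + (real n - expected_pulls R \<pi> \<mu>' n i)"
    using expected_pulls_two_environments[OF assms(2), where d = "2 * a" and n = n and \<mu> = \<mu> and i = i]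
    by (simp add: T_def \<mu>'_def a_def)
  finally have "a * (real n / 2 * (1 / sqrt x) - T) \<le> a * (real n - expected_pulls R \<pi> \<mu>' n i)"
    using a by (intro mult_left_mono) auto
  also have "real n - expected_pulls R \<pi> \<mu>' n i = (\<Sum>j\<in>-{i}. expected_pulls R \<pi> \<mu>' n j)"
    unfolding sum_expected_pulls[OF assms(2), of \<mu>' n, symmetric] Compl_eq_Diff_UNIV
    by (subst sum.remove[of UNIV i]) auto
  \<comment> \<open>Every arm other than \<open>i\<close> now has gap at least \<open>a\<close>,
    while \<open>i\<close> itself costs nothing.\<close>
  also have "a * \<dots> \<le> (\<Sum>j\<in>-{i}. gap \<mu>' j * expected_pulls R \<pi> \<mu>' n j)"
    unfolding sum_distrib_left using gap' gap_nonneg[of \<mu>]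
    by (intro sum_mono mult_right_mono expected_pulls_nonneg) auto
  also have "\<dots> = pseudo_regret R \<pi> \<mu>' n"
    unfolding pseudo_regret_eq_sum[OF assms(2)] Compl_eq_Diff_UNIV
    using gap' by (simp add: sum.remove[of UNIV i])
  finally have regret: "a * (real n / 2 * (1 / sqrt x) - T) \<le> pseudo_regret R \<pi> \<mu>' n" .
  \<comment> \<open>Eliminating \<open>n\<close> through the definition of \<open>x\<close> brings
    out the factor \<open>k * L\<close>, which matches the estimate for the sum.\<close>
  have "a * (real n / 2 * (1 / sqrt x)) = k * L * (x / sqrt x) / (2 * a)"
    unfolding nx using a by (simp add: power2_eq_square field_simps)
  also have "x / sqrt x = sqrt x" using x by (simp add: real_div_sqrt)
  finally have "a * (real n / 2 * (1 / sqrt x)) = k * L * sqrt x / (2 * a)" .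
  moreover have "a * T \<le> ln x / (4 * a)"
    using T a by (simp add: field_simps power2_eq_square)
  moreover have "(2 * k * L * sqrt x - ln x) / (4 * a) = k * L * sqrt x / (2 * a) - ln x / (4 * a)"
    by (simp add: diff_divide_distrib)
  ultimately have "(2 * k * L * sqrt x - ln x) / (4 * a) \<le> pseudo_regret R \<pi> \<mu>' n"
    using regret unfolding right_diff_distrib by linarith
  then have "2 * k * L * sqrt x - ln x \<le> 2 * a * (2 * pseudo_regret R \<pi> \<mu>' n)"
    using a by (simp add: divide_le_eq mult_ac)
  moreover have "2 * a * (\<Sum>j | gap \<mu>' j > 0.
      1 / gap \<mu>' j * ln (real n * (gap \<mu>' j)\<^sup>2 / (k_half \<mu>' j * L))) \<le> 2 * k * L * sqrt x - ln x"
    unfolding \<mu>'_def a_def L_def k_def x_def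
    by (rule sum_modified_gaps_le[OF assms(1,3) i assms(4)])
  ultimately have "2 * a * (\<Sum>j | gap \<mu>' j > 0.
      1 / gap \<mu>' j * ln (real n * (gap \<mu>' j)\<^sup>2 / (k_half \<mu>' j * L)))
      \<le> 2 * a * (2 * pseudo_regret R \<pi> \<mu>' n)"
    by linarith
  then have "(\<Sum>j | gap \<mu>' j > 0.
      1 / gap \<mu>' j * ln (real n * (gap \<mu>' j)\<^sup>2 / (k_half \<mu>' j * L))) \<le> 2 * pseudo_regret R \<pi> \<mu>' n"
    using a by (subst (asm) mult_le_cancel_left_pos) auto
  then have "1 / 2 * (\<Sum>j | gap \<mu>' j > 0.
      1 / gap \<mu>' j * ln (real n * (gap \<mu>' j)\<^sup>2 / (k_half \<mu>' j * L))) \<le> pseudo_regret R \<pi> \<mu>' n"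
    by linarith
  then show "\<exists>i. gap \<mu> i > 0 \<and>
      (let \<mu>' = \<mu>(i := \<mu> i + 2 * gap \<mu> i) in pseudo_regret R \<pi> \<mu>' n \<ge>
        1 / 2 * (\<Sum>j | gap \<mu>' j > 0.
          1 / gap \<mu>' j * ln (real n * (gap \<mu>' j)\<^sup>2 / (k_half \<mu>' j * ln (real n)))))"
    using i by (auto simp: \<mu>'_def L_def Let_def)
qed

end
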